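(* Let $n\in\mathbb{N}$, let $\mathcal{N}\subset\mathbb{R}^n$ be a neighbourhood of the origin, and let $f:\mathcal{N}\to\mathbb{R}$ be a function with $f(\mathbf{0})=0$. Then $f$ is continuous at the origin if and only if for every real $a>0$ and every path $\mathbf{s}\in[\mathcal{C}^\infty(]0,a[)]^n$ such that $$\lim_{t\to 0+}\mathbf{s}(t)=\mathbf{0}\quad\text{and}\quad \sup_{t\in\,]0,a[}\|\mathbf{s}(t)\|\,\|\mathbf{s}'(t)\|<+\infty,$$ we have $$\lim_{t\to 0+}f(\mathbf{s}(t))=0.$$
   Context: $\mathbb{N}$ denotes the set of integers larger than zero and $\|\cdot\|$ the Euclidean norm on $\mathbb{R}^n$. $]0,a[$ is the open interval from $0$ to $a$, and $[\mathcal{C}^\infty(]0,a[)]^n$ is the set of infinitely differentiable functions $]0,a[\,\to\mathbb{R}^n$; $\mathbf{s}'$ is the derivative of $\mathbf{s}$. Since $\mathbf{s}(t)\to\mathbf{0}$ and $\mathcal{N}$ is a neighbourhood of the origin, $f(\mathbf{s}(t))$ is defined for all sufficiently small $t>0$, which is all that is needed for the limit $\lim_{t\to 0+}f(\mathbf{s}(t))$; $\mathbf{s}$ is not required to take values in $\mathcal{N}$ on all of $]0,a[$. *)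

theory Defs
  imports "HOL-Analysis.Analysis"
begin

definition nth_vector_derivative ::
    "nat \<Rightarrow> (real \<Rightarrow> 'a::real_normed_vector) \<Rightarrow> real \<Rightarrow> 'a" where
  "nth_vector_derivative k s = ((\<lambda>g t. vector_derivative g (at t)) ^^ k) s"

(* Intended for open S only: derivatives are taken with "at t" rather than "at t within S",
   so for open S the values of s outside S are irrelevant. *)
definition smooth_on :: "real set \<Rightarrow> (real \<Rightarrow> 'a::real_normed_vector) \<Rightarrow> bool" where
  "smooth_on S s \<longleftrightarrow> (\<forall>k. \<forall>t\<in>S. nth_vector_derivative k s differentiable (at t))"

end

theory Submission
  imports Defs "HOL-Real_Asymp.Real_Asymp"
begin

text \<open>
  If \<open>f\<close> is continuous at the origin, then \<open>f \<circ> s\<close> has the limit \<open>f 0 = 0\<close> along a path \<open>s\<close>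
  that tends to the origin, by composition of limits.

  If \<open>f\<close> is not continuous at the origin, there is an \<open>e > 0\<close> and, for every \<open>m\<close>, a point \<open>x m\<close>
  with \<open>\<bar>f (x m)\<bar> \<ge> e\<close> and \<open>norm (x m) \<le> 1 / (m + 1)\<close>. All these points lie on one admissible path,
  which visits \<open>x m\<close> during the time when \<open>1 / t\<close> runs through \<open>[m, m + 1)\<close>, and along which \<open>f\<close>
  therefore does not tend to 0. The path is \<open>s(t) = h(t) *\<^sub>R x \<lfloor>1 / t\<rfloor>\<close> with \<open>h(t) = \<phi>(sin (2 \<pi> / t))\<close>,
  where \<open>\<phi>(v) = exp (1 - 1 / v)\<close> for \<open>v > 0\<close> and \<open>\<phi>(v) = 0\<close> otherwise. The function \<open>\<phi>\<close> is smooth,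
  and \<open>h\<close> vanishes while \<open>1 / t\<close> is in the second half of \<open>[m, m + 1)\<close>, so that the index of \<open>x\<close>
  changes while the path rests at the origin and no smoothness is lost (lemma
  \<open>times_differentiable_switch\<close>). At \<open>1 / t = m + 1/4\<close> the sine is 1, so that \<open>h(t) = 1\<close> and \<open>s(t) = x m\<close>.
  The chain rule gives \<open>\<bar>h'(t)\<bar> \<le> C / t\<^sup>2 \<le> C (m + 1)\<^sup>2\<close>, and this growth is compensated by the two factors
  \<open>norm (x m) \<le> 1 / (m + 1)\<close> of \<open>norm (s t) * norm (s' t)\<close> (lemma \<open>smooth_path_through_sequence\<close>).
\<close>

section \<open>Calculus of repeatedly differentiable functions\<close>

text \<open>The derivative is quantified existentially, so that a closure property follows by induction
  from the matching differentiation rule, without computing any \<open>vector_derivative\<close>.\<close>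

fun times_differentiable :: "nat \<Rightarrow> real set \<Rightarrow> (real \<Rightarrow> 'a::real_normed_vector) \<Rightarrow> bool" where
  "times_differentiable 0 S f \<longleftrightarrow> True"
| "times_differentiable (Suc k) S f \<longleftrightarrow>
     (\<exists>f'. (\<forall>t\<in>S. (f has_vector_derivative f' t) (at t)) \<and> times_differentiable k S f')"

lemma times_differentiable_SucI:
  assumes "\<And>t. t \<in> S \<Longrightarrow> (f has_vector_derivative f' t) (at t)"
    and "times_differentiable k S f'"
  shows "times_differentiable (Suc k) S f"
  using assms by auto

lemma nth_vector_derivative_cong:
  assumes "open S" and "\<And>t. t \<in> S \<Longrightarrow> f t = g t" and "t \<in> S"
  shows "nth_vector_derivative k f t = nth_vector_derivative k g t"
  using assms(3)
proof (induction k arbitrary: t)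
  case 0
  then show ?case
    using assms(2) by (simp add: nth_vector_derivative_def)
next
  case (Suc k)
  have "eventually (\<lambda>u. u \<in> S) (nhds t)"
    using Suc.prems assms(1) eventually_nhds by blast
  then have "eventually (\<lambda>u. nth_vector_derivative k f u = nth_vector_derivative k g u) (nhds t)"
    by (rule eventually_mono) (rule Suc.IH)
  then have "vector_derivative (nth_vector_derivative k f) (at t) =
      vector_derivative (nth_vector_derivative k g) (at t)"
    by (intro vector_derivative_cong_eq) auto
  then show ?case
    by (simp add: nth_vector_derivative_def)
qed

lemma nth_vector_derivative_differentiable:
  assumes "open S" and "times_differentiable (Suc k) S f" and "t \<in> S"
  shows "nth_vector_derivative k f differentiable (at t)"
  using assms(2)
proof (induction k arbitrary: f)
  case 0
  then show ?case
    using assms(3) by (auto simp: nth_vector_derivative_def intro: differentiableI_vector)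
next
  case (Suc k)
  then obtain f' where f': "\<And>u. u \<in> S \<Longrightarrow> (f has_vector_derivative f' u) (at u)"
    and smooth: "times_differentiable (Suc k) S f'"
    by (subst (asm) times_differentiable.simps(2)) blast
  have eq: "nth_vector_derivative (Suc k) f u = nth_vector_derivative k f' u" if "u \<in> S" for u
  proof -
    have "nth_vector_derivative k (\<lambda>u. vector_derivative f (at u)) u = nth_vector_derivative k f' u"
      using assms(1) that f' by (intro nth_vector_derivative_cong) (auto intro: vector_derivative_at)
    then show ?thesis
      by (simp add: nth_vector_derivative_def funpow_Suc_right del: funpow.simps)
  qed
  from Suc.IH[OF smooth] obtain D where "(nth_vector_derivative k f' has_derivative D) (at t)"
    by (auto simp: differentiable_def)
  then have "(nth_vector_derivative (Suc k) f has_derivative D) (at t)"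
    by (rule has_derivative_transform_within_open[OF _ assms(1,3)]) (simp add: eq)
  then show ?case
    by (auto simp: differentiable_def)
qed

lemma smooth_onI:
  assumes "open S" and "\<And>k. times_differentiable k S f"
  shows "smooth_on S f"
  unfolding smooth_on_def using nth_vector_derivative_differentiable assms by blast

lemma times_differentiable_lessI:
  assumes "times_differentiable (Suc k) S f"
  shows "times_differentiable k S f"
  using assms
proof (induction k arbitrary: f)
  case (Suc k)
  then obtain f' where "\<forall>t\<in>S. (f has_vector_derivative f' t) (at t)"
    and "times_differentiable (Suc k) S f'"
    by (subst (asm) times_differentiable.simps(2)) blast
  then show ?case
    using Suc.IH[of f'] by (intro times_differentiable_SucI) auto
qed simp

lemma times_differentiable_subset:
  assumes "times_differentiable k T f" and "S \<subseteq> T"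
  shows "times_differentiable k S f"
  using assms(1)
proof (induction k arbitrary: f)
  case (Suc k)
  then show ?case
    using assms(2) by auto
qed simp

lemma times_differentiable_const: "times_differentiable k S (\<lambda>t. c)"
proof (induction k arbitrary: c)
  case (Suc k)
  show ?case
    by (rule times_differentiable_SucI[OF _ Suc.IH]) (rule has_vector_derivative_const)
qed simp

lemma times_differentiable_add:
  assumes "times_differentiable k S f" and "times_differentiable k S g"
  shows "times_differentiable k S (\<lambda>t. f t + g t)"
  using assms
proof (induction k arbitrary: f g)
  case (Suc k)
  then obtain f' g' where d: "\<forall>t\<in>S. (f has_vector_derivative f' t) (at t)"
      "\<forall>t\<in>S. (g has_vector_derivative g' t) (at t)"
    and smooth: "times_differentiable k S f'" "times_differentiable k S g'"
    unfolding times_differentiable.simps by blast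
  show ?case
    by (rule times_differentiable_SucI[OF _ Suc.IH[OF smooth]])
      (use d in \<open>auto intro: has_vector_derivative_add\<close>)
qed simp

lemma times_differentiable_mult:
  fixes f g :: "real \<Rightarrow> real"
  assumes "times_differentiable k S f" and "times_differentiable k S g"
  shows "times_differentiable k S (\<lambda>t. f t * g t)"
  using assms
proof (induction k arbitrary: f g)
  case (Suc k)
  then obtain f' g' where d: "\<forall>t\<in>S. (f has_vector_derivative f' t) (at t)"
      "\<forall>t\<in>S. (g has_vector_derivative g' t) (at t)"
    and smooth: "times_differentiable k S f'" "times_differentiable k S g'"
    unfolding times_differentiable.simps by blast
  have "times_differentiable k S (\<lambda>t. f t * g' t + f' t * g t)"
    by (intro times_differentiable_add Suc.IH smooth
        times_differentiable_lessI[OF Suc.prems(1)] times_differentiable_lessI[OF Suc.prems(2)])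
  then show ?case
    by (rule times_differentiable_SucI[rotated]) (use d in \<open>auto intro: has_vector_derivative_mult\<close>)
qed simp

lemma times_differentiable_compose:
  fixes f g :: "real \<Rightarrow> real"
  assumes "times_differentiable k T f" and "times_differentiable k S g" and "g ` S \<subseteq> T"
  shows "times_differentiable k S (\<lambda>t. f (g t))"
  using assms(1,2)
proof (induction k arbitrary: f)
  case (Suc k)
  then obtain f' g' where d: "\<forall>t\<in>T. (f has_vector_derivative f' t) (at t)"
      "\<forall>t\<in>S. (g has_vector_derivative g' t) (at t)"
    and smooth: "times_differentiable k T f'" "times_differentiable k S g'"
    unfolding times_differentiable.simps by blast
  have "times_differentiable k S (\<lambda>t. g' t * f' (g t))"
    by (rule times_differentiable_mult[OF smooth(2)
          Suc.IH[OF smooth(1) times_differentiable_lessI[OF Suc.prems(2)]]])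
  moreover have "((\<lambda>t. f (g t)) has_vector_derivative g' t * f' (g t)) (at t)" if "t \<in> S" for t
  proof -
    have "((f \<circ> g) has_vector_derivative g' t *\<^sub>R f' (g t)) (at t)"
      using d that assms(3) by (intro vector_diff_chain_at) auto
    then show ?thesis
      by (simp add: o_def)
  qed
  ultimately show ?case
    by (rule times_differentiable_SucI[rotated])
qed simp

lemma times_differentiable_sin_cos:
  "times_differentiable k S (sin :: real \<Rightarrow> real)"
  "times_differentiable k S (cos :: real \<Rightarrow> real)"
proof (induction k)
  case (Suc k)
  have "times_differentiable k S (\<lambda>t::real. - 1 * sin t)"
    by (intro times_differentiable_mult times_differentiable_const Suc.IH)
  then show "times_differentiable (Suc k) S (cos :: real \<Rightarrow> real)"
    by (rule times_differentiable_SucI[rotated])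
      (auto simp flip: has_real_derivative_iff_has_vector_derivative intro!: derivative_eq_intros)
  show "times_differentiable (Suc k) S (sin :: real \<Rightarrow> real)"
    by (rule times_differentiable_SucI[OF _ Suc.IH(2)])
      (auto simp flip: has_real_derivative_iff_has_vector_derivative intro!: derivative_eq_intros)
qed auto

lemma times_differentiable_inverse:
  assumes "0 \<notin> S"
  shows "times_differentiable k S (inverse :: real \<Rightarrow> real)"
proof (induction k)
  case (Suc k)
  have "times_differentiable k S (\<lambda>t::real. - 1 * (inverse t * inverse t))"
    by (intro times_differentiable_mult times_differentiable_const Suc.IH)
  then show ?case
    by (rule times_differentiable_SucI[rotated])
      (use assms in \<open>auto simp flip: has_real_derivative_iff_has_vector_derivative
        intro!: derivative_eq_intros simp: power2_eq_square\<close>)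
qed simp

section \<open>A smooth function that vanishes on a half-line\<close>

text \<open>The factors \<open>(1 / v) ^ k\<close> make the linear span of the family closed under differentiation;
  only \<open>flat 0\<close> occurs in the path. The constant in the exponent normalises \<open>flat k 1\<close> to 1.\<close>

definition flat :: "nat \<Rightarrow> real \<Rightarrow> real" where
  "flat k v = (if v > 0 then (1 / v) ^ k * exp (1 - 1 / v) else 0)"

lemma flat_nonpos: "v \<le> 0 \<Longrightarrow> flat k v = 0"
  by (simp add: flat_def)

lemma flat_0_bounds: "0 \<le> flat 0 v" "v \<le> 1 \<Longrightarrow> flat 0 v \<le> 1"
  by (auto simp: flat_def)

text \<open>With \<open>u = 1 / v\<close> this is the fact that \<open>u ^ k\<close> grows more slowly than \<open>exp u\<close>.\<close>

lemma flat_tendsto_0: "(flat k \<longlongrightarrow> 0) (at 0)"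
proof -
  have "((\<lambda>u. exp 1 * (u ^ k / exp u)) \<longlongrightarrow> exp 1 * 0) (at_top :: real filter)"
    by (intro tendsto_mult tendsto_const tendsto_power_div_exp_0)
  then have "((\<lambda>v. exp 1 * (inverse v ^ k / exp (inverse v))) \<longlongrightarrow> 0) (at_right (0::real))"
    using filterlim_compose[OF _ filterlim_inverse_at_top_right] by fastforce
  moreover have "eventually (\<lambda>v. exp 1 * (inverse v ^ k / exp (inverse v)) = flat k v) (at_right 0)"
    unfolding eventually_at_right_field
    by (rule exI[of _ 1]) (auto simp: flat_def exp_diff divide_inverse)
  ultimately have right: "(flat k \<longlongrightarrow> 0) (at_right 0)"
    by (rule Lim_transform_eventually)
  have "eventually (\<lambda>v. 0 = flat k v) (at_left 0)"
    unfolding eventually_at_left_field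
    by (rule exI[of _ "-1"]) (auto simp: flat_def)
  then have "(flat k \<longlongrightarrow> 0) (at_left 0)"
    by (rule Lim_transform_eventually[OF tendsto_const])
  with right show ?thesis
    by (simp add: filterlim_at_split)
qed

lemma flat_has_derivative:
  "(flat k has_real_derivative flat (k + 2) v + - real k * flat (k + 1) v) (at v)"
proof -
  consider "v > 0" | "v < 0" | "v = 0" by linarith
  then show ?thesis
  proof cases
    case 1
    have "((\<lambda>v. (1 / v) ^ k * exp (1 - 1 / v)) has_real_derivative
        flat (k + 2) v + - real k * flat (k + 1) v) (at v)"
      using 1 by (cases k; auto intro!: derivative_eq_intros
          simp: flat_def field_simps power2_eq_square)
        (metis One_nat_def Suc_pred neq0_conv power_Suc)
    then show ?thesis
      by (rule has_field_derivative_transform_within_open[where S = "{0<..}"])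
        (use 1 in \<open>auto simp: flat_def\<close>)
  next
    case 2
    have "((\<lambda>v. 0) has_real_derivative flat (k + 2) v + - real k * flat (k + 1) v) (at v)"
      using 2 by (simp add: flat_nonpos)
    then show ?thesis
      by (rule has_field_derivative_transform_within_open[where S = "{..<0}"])
        (use 2 in \<open>auto simp: flat_def\<close>)
  next
    case 3
    \<comment> \<open>The difference quotient at 0 is again a member of the family.\<close>
    have "(flat k (0 + h) - flat k 0) / h = flat (Suc k) h" for h
      by (auto simp: flat_def)
    then have "(flat k has_real_derivative 0) (at 0)"
      unfolding DERIV_def using flat_tendsto_0[of "Suc k"] by simp
    then show ?thesis
      using 3 by (simp add: flat_nonpos)
  qed
qed

lemma times_differentiable_flat: "times_differentiable n S (flat k)"
proof (induction n arbitrary: k)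
  case (Suc n)
  have "times_differentiable n S (\<lambda>v. flat (k + 2) v + - real k * flat (k + 1) v)"
    by (intro times_differentiable_add times_differentiable_mult times_differentiable_const Suc.IH)
  then show ?case
    by (rule times_differentiable_SucI[rotated])
      (use flat_has_derivative in \<open>simp flip: has_real_derivative_iff_has_vector_derivative\<close>)
qed simp

lemma flat_bounded_on_interval: "\<exists>M>0. \<forall>v\<in>{-1..1}. \<bar>flat k v\<bar> \<le> M"
proof -
  have "continuous_on {-1..1} (flat k)"
    by (intro continuous_at_imp_continuous_on ballI DERIV_isCont[OF flat_has_derivative])
  then have "bounded (flat k ` {-1..1})"
    by (intro compact_imp_bounded compact_continuous_image) auto
  then show ?thesis
    by (auto simp: bounded_pos)
qed

section \<open>Paths that switch between points\<close>

text \<open>The index is constant while \<open>1 / t\<close> is in \<open>[m, m + 1)\<close>. Just below \<open>m\<close> the factor \<open>h\<close> is 0, and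
  the index may be replaced by \<open>m\<close>: so the formula holds with this fixed index on an open set.\<close>

lemma switch_has_vector_derivative:
  fixes x :: "nat \<Rightarrow> 'a::real_normed_vector"
  assumes h': "(h has_vector_derivative h') (at t)" and "t > 0"
    and zero: "\<And>t. t > 0 \<Longrightarrow> frac (1 / t) > 1/2 \<Longrightarrow> h t = 0"
  shows "((\<lambda>t. h t *\<^sub>R x (nat \<lfloor>1 / t\<rfloor>)) has_vector_derivative h' *\<^sub>R x (nat \<lfloor>1 / t\<rfloor>)) (at t)"
proof -
  define m where "m = \<lfloor>1 / t\<rfloor>"
  define U where "U = {0<..} \<inter> (\<lambda>u. 1 / u) -` {real_of_int m - 1/2 <..< real_of_int m + 1}"
  have "open U"
    unfolding U_def by (intro continuous_open_preimage continuous_intros) auto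
  have "t \<in> U"
    using \<open>t > 0\<close> unfolding U_def m_def by (auto, linarith+)
  have "((\<lambda>u. h u *\<^sub>R x (nat m)) has_vector_derivative h' *\<^sub>R x (nat m)) (at t)"
    using h' by (intro has_vector_derivative_scaleR[THEN has_vector_derivative_eq_rhs]
        has_vector_derivative_const)
      (auto simp: has_real_derivative_iff_has_vector_derivative)
  then have "((\<lambda>u. h u *\<^sub>R x (nat \<lfloor>1 / u\<rfloor>)) has_vector_derivative h' *\<^sub>R x (nat m)) (at t)"
  proof (rule has_vector_derivative_transform_within_open[OF _ \<open>open U\<close> \<open>t \<in> U\<close>])
    fix u assume u: "u \<in> U"
    show "h u *\<^sub>R x (nat m) = h u *\<^sub>R x (nat \<lfloor>1 / u\<rfloor>)"
    proof (cases "\<lfloor>1 / u\<rfloor> = m")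
      case False
      with u have "\<lfloor>1 / u\<rfloor> = m - 1"
        by (auto simp: U_def) linarith
      then have "frac (1 / u) > 1/2"
        using u by (auto simp: U_def frac_def)
      then show ?thesis
        using zero u by (auto simp: U_def)
    qed simp
  qed
  then show ?thesis
    by (simp add: m_def)
qed

text \<open>The induction goes through because the derivative of \<open>h\<close> vanishes on the same open set as \<open>h\<close>.\<close>

lemma times_differentiable_switch:
  fixes x :: "nat \<Rightarrow> 'a::real_normed_vector"
  assumes "times_differentiable k {0<..} h"
    and "\<And>t. t > 0 \<Longrightarrow> frac (1 / t) > 1/2 \<Longrightarrow> h t = 0"
  shows "times_differentiable k {0<..} (\<lambda>t. h t *\<^sub>R x (nat \<lfloor>1 / t\<rfloor>))"
  using assms
proof (induction k arbitrary: h)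
  case (Suc k)
  then obtain h' where h': "\<And>t. t > 0 \<Longrightarrow> (h has_vector_derivative h' t) (at t)"
    and smooth: "times_differentiable k {0<..} h'"
    by auto
  have "h' t = 0" if "t > 0" "frac (1 / t) > 1/2" for t
  proof -
    define m where "m = \<lfloor>1 / t\<rfloor>"
    define U where "U = {0<..} \<inter> (\<lambda>u. 1 / u) -` {real_of_int m + 1/2 <..< real_of_int m + 1}"
    have "open U"
      unfolding U_def by (intro continuous_open_preimage continuous_intros) auto
    have "t \<in> U"
      using that frac_lt_1[of "1 / t"] by (auto simp: U_def m_def frac_def)
    have "((\<lambda>u. 0) has_vector_derivative h' t) (at t)"
    proof (rule has_vector_derivative_transform_within_open[OF h'[OF that(1)] \<open>open U\<close> \<open>t \<in> U\<close>])
      fix u assume u: "u \<in> U"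
      then have "\<lfloor>1 / u\<rfloor> = m"
        by (auto simp: U_def) linarith
      then show "h u = 0"
        using u by (intro Suc.prems(2)) (auto simp: U_def frac_def)
    qed
    then show ?thesis
      using vector_derivative_unique_at has_vector_derivative_const by blast
  qed
  then have "times_differentiable k {0<..} (\<lambda>t. h' t *\<^sub>R x (nat \<lfloor>1 / t\<rfloor>))"
    by (rule Suc.IH[OF smooth])
  then show ?case
    by (rule times_differentiable_SucI[rotated])
      (use h' Suc.prems(2) in \<open>auto intro: switch_has_vector_derivative\<close>)
qed simp

text \<open>One turn of the sine per unit of \<open>1 / t\<close>: a positive first half, which produces the excursion
  to \<open>x m\<close>, and a negative second half, which produces the rest at the origin.\<close>

definition pulse :: "real \<Rightarrow> real" where
  "pulse t = flat 0 (sin (2 * pi * (1 / t)))"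

lemma pulse_eq_0:
  assumes "frac (1 / t) > 1/2"
  shows "pulse t = 0"
proof -
  have "sin (2 * pi * (1 / t)) = sin (2 * pi * frac (1 / t) + 2 * pi * of_int \<lfloor>1 / t\<rfloor>)"
    by (simp add: frac_def algebra_simps)
  also have "\<dots> = sin (2 * pi * frac (1 / t))"
    by (simp add: sin_add sin_int_2pin cos_int_2pin)
  also have "\<dots> \<le> 0"
  proof (rule sin_le_zero)
    show "pi \<le> 2 * pi * frac (1 / t)"
      using assms by simp
    show "2 * pi * frac (1 / t) < 2 * pi"
      using frac_lt_1[of "1 / t"] by simp
  qed
  finally show ?thesis
    by (simp add: pulse_def flat_nonpos)
qed

lemma pulse_peak: "pulse (1 / (real m + 1/4)) = 1"
proof -
  have "sin (2 * pi * (real m + 1/4)) = sin (pi / 2 + 2 * pi * real m)"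
    by (simp add: algebra_simps)
  also have "\<dots> = 1"
    by (simp add: sin_add cos_int_2pin[of "int m", simplified])
  finally have "sin (2 * pi * (real m + 1/4)) = 1" .
  then show ?thesis
    by (simp add: pulse_def flat_def)
qed

lemma pulse_bounds: "0 \<le> pulse t" "pulse t \<le> 1"
  by (simp_all add: pulse_def flat_0_bounds)

lemma times_differentiable_pulse: "times_differentiable k {0<..} pulse"
proof -
  have "times_differentiable k {0<..} (\<lambda>t::real. 2 * pi * inverse t)"
    by (intro times_differentiable_mult times_differentiable_const times_differentiable_inverse) simp
  from times_differentiable_compose[OF times_differentiable_sin_cos(1)[of k UNIV] this]
  have "times_differentiable k {0<..} (\<lambda>t. sin (2 * pi * inverse t))"
    by simp
  from times_differentiable_compose[OF times_differentiable_flat[of k UNIV 0] this]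
  have "times_differentiable k {0<..} (\<lambda>t. flat 0 (sin (2 * pi * inverse t)))"
    by simp
  then show ?thesis
    by (simp add: pulse_def[abs_def] inverse_eq_divide)
qed

lemma pulse_derivative_bound:
  "\<exists>C>0. \<forall>t>0. \<exists>d. (pulse has_vector_derivative d) (at t) \<and> \<bar>d\<bar> \<le> C * (1 / t)\<^sup>2"
proof -
  obtain M where M: "M > 0" "\<And>v. v \<in> {-1..1} \<Longrightarrow> \<bar>flat 2 v\<bar> \<le> M"
    using flat_bounded_on_interval[of 2] by metis
  have "\<exists>d. (pulse has_vector_derivative d) (at t) \<and> \<bar>d\<bar> \<le> (M * (2 * pi)) * (1 / t)\<^sup>2"
    if "t > 0" for t
  proof -
    let ?a = "2 * pi * (1 / t)"
    define d where "d = flat 2 (sin ?a) * (cos ?a * (2 * pi * (- (1 / t)\<^sup>2)))"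
    have inner: "((\<lambda>t. sin (2 * pi * (1 / t))) has_real_derivative
        cos ?a * (2 * pi * (- (1 / t)\<^sup>2))) (at t)"
      using that by (auto intro!: derivative_eq_intros simp: power2_eq_square)
    have "(flat 0 has_real_derivative flat 2 (sin ?a)) (at (sin ?a))"
      using flat_has_derivative[of 0 "sin ?a"] by (simp add: numeral_2_eq_2)
    from DERIV_chain2[OF this inner] have "(pulse has_real_derivative d) (at t)"
      by (simp add: pulse_def[abs_def] d_def)
    moreover have "\<bar>d\<bar> \<le> (M * (2 * pi)) * (1 / t)\<^sup>2"
    proof -
      have "\<bar>d\<bar> = (\<bar>flat 2 (sin ?a)\<bar> * \<bar>cos ?a\<bar>) * (2 * pi * (1 / t)\<^sup>2)"
        by (simp add: d_def abs_mult)
      also have "\<dots> \<le> (M * 1) * (2 * pi * (1 / t)\<^sup>2)"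
        using M by (intro mult_right_mono mult_mono) auto
      finally show ?thesis
        by (simp add: mult.assoc)
    qed
    ultimately show ?thesis
      by (auto simp: has_real_derivative_iff_has_vector_derivative)
  qed
  moreover have "M * (2 * pi) > 0"
    using M(1) by simp
  ultimately show ?thesis
    by blast
qed

lemma smooth_path_through_sequence:
  fixes x :: "nat \<Rightarrow> 'a::real_normed_vector"
  assumes x: "\<And>m. norm (x m) \<le> 1 / (real m + 1)"
  obtains s :: "real \<Rightarrow> 'a" and C :: real
  where "\<And>k. times_differentiable k {0<..} s" and "(s \<longlongrightarrow> 0) (at_right 0)"
    and "\<And>t. t > 0 \<Longrightarrow> norm (s t) * norm (vector_derivative s (at t)) \<le> C"
    and "\<And>m. s (1 / (real m + 1/4)) = x m"
proof -
  define s where "s = (\<lambda>t. pulse t *\<^sub>R x (nat \<lfloor>1 / t\<rfloor>))"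
  obtain C where C: "C > 0"
    "\<And>t. t > 0 \<Longrightarrow> \<exists>d. (pulse has_vector_derivative d) (at t) \<and> \<bar>d\<bar> \<le> C * (1 / t)\<^sup>2"
    using pulse_derivative_bound by blast
  have x_le: "norm (x (nat \<lfloor>1 / t\<rfloor>)) \<le> t" if "t > 0" for t
  proof -
    define c where "c = real (nat \<lfloor>1 / t\<rfloor>) + 1"
    have "1 / t \<le> c" and "c > 0"
      unfolding c_def using that by linarith+
    then have "1 / c \<le> t"
      using that by (simp add: field_simps)
    then have "1 / (real (nat \<lfloor>1 / t\<rfloor>) + 1) \<le> t"
      by (simp add: c_def)
    then show ?thesis
      using x order_trans by blast
  qed
  have s_le: "norm (s t) \<le> t" if "t > 0" for t
  proof -
    have "norm (s t) \<le> 1 * norm (x (nat \<lfloor>1 / t\<rfloor>))"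
      unfolding s_def norm_scaleR using pulse_bounds[of t] by (intro mult_right_mono) auto
    then show ?thesis
      using x_le[OF that] by simp
  qed
  show thesis
  proof
    show "times_differentiable k {0<..} s" for k
      unfolding s_def by (intro times_differentiable_switch times_differentiable_pulse pulse_eq_0)
    show "(s \<longlongrightarrow> 0) (at_right 0)"
    proof (rule Lim_null_comparison)
      show "eventually (\<lambda>t. norm (s t) \<le> t) (at_right 0)"
        unfolding eventually_at_right_field by (rule exI[of _ 1]) (auto simp: s_le)
      show "((\<lambda>t. t) \<longlongrightarrow> (0::real)) (at_right 0)"
        by (rule tendsto_ident_at)
    qed
    show "norm (s t) * norm (vector_derivative s (at t)) \<le> C" if "t > 0" for t
    proof -
      obtain d where d: "(pulse has_vector_derivative d) (at t)" "\<bar>d\<bar> \<le> C * (1 / t)\<^sup>2"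
        using C(2)[OF \<open>t > 0\<close>] by blast
      have "vector_derivative s (at t) = d *\<^sub>R x (nat \<lfloor>1 / t\<rfloor>)"
        unfolding s_def using that pulse_eq_0
        by (intro vector_derivative_at switch_has_vector_derivative d) auto
      then have "norm (vector_derivative s (at t)) \<le> (C * (1 / t)\<^sup>2) * t"
        using d(2) x_le[OF that] C(1) by (auto intro!: mult_mono)
      then have "norm (s t) * norm (vector_derivative s (at t)) \<le> t * ((C * (1 / t)\<^sup>2) * t)"
        using s_le[OF that] that by (intro mult_mono) auto
      also have "\<dots> = C"
        using that by (simp add: power2_eq_square)
      finally show ?thesis .
    qed
    show "s (1 / (real m + 1/4)) = x m" for m
    proof -
      have "\<lfloor>real m + 1/4\<rfloor> = int m"
        by linarith
      then show ?thesis
        by (simp only: s_def pulse_peak) simp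
    qed
  qed
qed

section \<open>Continuity along smooth paths\<close>

theorem lemma3:
  fixes N :: "(real ^ 'n) set" and f :: "real ^ 'n \<Rightarrow> real"
  assumes "0 \<in> interior N" and "f 0 = 0"
  shows "continuous (at 0 within N) f \<longleftrightarrow>
    (\<forall>a>0. \<forall>s :: real \<Rightarrow> real ^ 'n.
       smooth_on {0<..<a} s \<longrightarrow>
       (s \<longlongrightarrow> 0) (at_right 0) \<longrightarrow>
       (SUP t\<in>{0<..<a}. ereal (norm (s t) * norm (vector_derivative s (at t)))) < \<infinity> \<longrightarrow>
       ((\<lambda>t. f (s t)) \<longlongrightarrow> 0) (at_right 0))"
    (is "_ \<longleftrightarrow> ?paths")
proof
  assume "continuous (at 0 within N) f"
  then have "isCont f 0"
    by (simp only: at_within_interior[OF assms(1)])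
  then have "((\<lambda>t. f (s t)) \<longlongrightarrow> f 0) (at_right 0)" if "(s \<longlongrightarrow> 0) (at_right 0)" for s
    using isCont_tendsto_compose that by blast
  then show ?paths
    unfolding assms(2) by blast
next
  assume paths: ?paths
  show "continuous (at 0 within N) f"
  proof (rule ccontr)
    assume "\<not> continuous (at 0 within N) f"
    then have "\<exists>e>0. \<forall>d>0. \<exists>x\<in>N. norm x < d \<and> \<bar>f x\<bar> \<ge> e"
      unfolding continuous_within_eps_delta by (simp add: assms(2) dist_norm) (meson not_less)
    then obtain e where "e > 0" and e: "\<And>d. d > 0 \<Longrightarrow> \<exists>x\<in>N. norm x < d \<and> \<bar>f x\<bar> \<ge> e"
      by metis
    have "\<exists>x. norm x \<le> 1 / (real m + 1) \<and> \<bar>f x\<bar> \<ge> e" for m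
      using e[of "1 / (real m + 1)"] by force
    then obtain x where x: "\<And>m. norm (x m) \<le> 1 / (real m + 1)" "\<And>m. \<bar>f (x m)\<bar> \<ge> e"
      by metis
    obtain s C where s: "\<And>k. times_differentiable k {0<..} s" "(s \<longlongrightarrow> 0) (at_right 0)"
        "\<And>t. t > 0 \<Longrightarrow> norm (s t) * norm (vector_derivative s (at t)) \<le> C"
      and hits: "\<And>m. s (1 / (real m + 1/4)) = x m"
      using smooth_path_through_sequence[of x] x(1) by blast
    have "smooth_on {0<..<1} s"
      by (intro smooth_onI times_differentiable_subset[OF s(1)]) auto
    moreover have "(SUP t\<in>{0<..<1}. ereal (norm (s t) * norm (vector_derivative s (at t)))) \<le> ereal C"
      using s(3) by (intro SUP_least) auto
    then have "(SUP t\<in>{0<..<1}. ereal (norm (s t) * norm (vector_derivative s (at t)))) < \<infinity>"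
      by (rule le_less_trans) simp
    ultimately have "((\<lambda>t. f (s t)) \<longlongrightarrow> 0) (at_right 0)"
      using paths s(2) zero_less_one by blast
    moreover have "filterlim (\<lambda>m. 1 / (real m + 1/4)) (at_right 0) sequentially"
      by real_asymp
    ultimately have "(\<lambda>m. f (s (1 / (real m + 1/4)))) \<longlonglongrightarrow> 0"
      by (rule filterlim_compose)
    then have "(\<lambda>m. f (x m)) \<longlonglongrightarrow> 0"
      by (simp only: hits)
    then have "eventually (\<lambda>m. \<bar>f (x m)\<bar> < e) sequentially"
      using \<open>e > 0\<close> by (auto dest: tendstoD[where e = e])
    then show False
      using x(2) by (auto simp: eventually_sequentially not_less[symmetric])
  qed
qed

end
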